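(* Let $G$ be a finite group, $g\in G'$ and $\omega(x_1,x_2,\dots,x_n)$ be a non-trivial admissible word. Then (a) $\Pr_g^{\omega}(G)\le\Pr_1^{\omega}(G)\le\Pr(G)$; (b) $\Pr_g^{\omega}(G)=\Pr_1^{\omega}(G)$ if and only if $g=1$.
   Context: $G'$ is the commutator subgroup of $G$; $\Pr(G)=|\{(x,y)\in G\times G:xy=yx\}|/|G|^2$. A word $\omega$ in the free group $F(x_1,\dots,x_n)$ is admissible if each generator $x_i$ that occurs in $\omega$ has precisely two non-zero indices in $\omega$, namely $+1$ and $-1$ (i.e. occurs exactly once as $x_i$ and exactly once as $x_i^{-1}$). For $g\in G$, $\Pr_g^{\omega}(G)=|\{(g_1,\dots,g_n)\in G^n:\omega(g_1,\dots,g_n)=g\}|/|G^n|$. *)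

theory Defs
  imports Complex_Main "HOL-Algebra.Generated_Groups"
begin

text \<open>A word in the generators \<open>x\<^sub>1, x\<^sub>2, \<dots>\<close> and their inverses is a list of letters, where
  \<open>Gen i\<close> stands for \<open>x\<^sub>i\<close> and \<open>GenInv i\<close> for its inverse.\<close>

datatype letter = Gen nat | GenInv nat

fun letter_index :: "letter \<Rightarrow> nat" where
  "letter_index (Gen i) = i"
| "letter_index (GenInv i) = i"

fun letter_inv :: "letter \<Rightarrow> letter" where
  "letter_inv (Gen i) = GenInv i"
| "letter_inv (GenInv i) = Gen i"

definition words :: "nat \<Rightarrow> letter list set" where
  "words n = {w. letter_index ` set w \<subseteq> {1..n}}"

text \<open>The free group on \<open>n\<close> generators is \<open>words n\<close> modulo \<open>free_eq\<close>. Words need not be reduced;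
  a word is trivial iff it represents the identity of the free group.\<close>

inductive cancel_step :: "letter list \<Rightarrow> letter list \<Rightarrow> bool" where
  "cancel_step (u @ [x, letter_inv x] @ v) (u @ v)"

definition free_eq :: "letter list \<Rightarrow> letter list \<Rightarrow> bool" where
  "free_eq = equivclp cancel_step"

definition nontrivial_word :: "letter list \<Rightarrow> bool" where
  "nontrivial_word w \<longleftrightarrow> \<not> free_eq w []"

definition admissible :: "letter list \<Rightarrow> bool" where
  "admissible w \<longleftrightarrow>
     (\<forall>i \<in> letter_index ` set w. count_list w (Gen i) = 1 \<and> count_list w (GenInv i) = 1)"

fun letter_val :: "('a, 'b) monoid_scheme \<Rightarrow> (nat \<Rightarrow> 'a) \<Rightarrow> letter \<Rightarrow> 'a" where
  "letter_val G a (Gen i) = a i"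
| "letter_val G a (GenInv i) = inv\<^bsub>G\<^esub> (a i)"

fun word_val :: "('a, 'b) monoid_scheme \<Rightarrow> (nat \<Rightarrow> 'a) \<Rightarrow> letter list \<Rightarrow> 'a" where
  "word_val G a [] = \<one>\<^bsub>G\<^esub>"
| "word_val G a (x # w) = letter_val G a x \<otimes>\<^bsub>G\<^esub> word_val G a w"

text \<open>Elements of \<open>G\<^sup>n\<close> are extensional functions on \<open>{1..n}\<close>.\<close>

definition tuples :: "('a, 'b) monoid_scheme \<Rightarrow> nat \<Rightarrow> (nat \<Rightarrow> 'a) set" where
  "tuples G n = {1..n} \<rightarrow>\<^sub>E carrier G"

definition Pr_word :: "('a, 'b) monoid_scheme \<Rightarrow> nat \<Rightarrow> letter list \<Rightarrow> 'a \<Rightarrow> real" where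
  "Pr_word G n w g = real (card {a \<in> tuples G n. word_val G a w = g}) / real (card (tuples G n))"

definition Pr_comm :: "('a, 'b) monoid_scheme \<Rightarrow> real" where
  "Pr_comm G =
     real (card {(x, y). x \<in> carrier G \<and> y \<in> carrier G \<and> x \<otimes>\<^bsub>G\<^esub> y = y \<otimes>\<^bsub>G\<^esub> x}) / (real (order G))\<^sup>2"

text \<open>Evaluation in \<open>G\<close> is well defined on the free group: see \<open>word_val_well_defined\<close> below.\<close>

lemma (in group) letter_val_closed:
  "a (letter_index x) \<in> carrier G \<Longrightarrow> letter_val G a x \<in> carrier G"
  by (cases x) auto

lemma (in group) word_val_closed:
  "(\<And>i. a i \<in> carrier G) \<Longrightarrow> word_val G a w \<in> carrier G"
  by (induction w) (auto simp: letter_val_closed)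

lemma (in group) word_val_append:
  assumes "\<And>i. a i \<in> carrier G"
  shows "word_val G a (u @ v) = word_val G a u \<otimes> word_val G a v"
  by (induction u) (auto simp: assms letter_val_closed word_val_closed m_assoc)

lemma (in group) word_val_free_eq:
  assumes a: "\<And>i. a i \<in> carrier G" and eq: "free_eq u v"
  shows "word_val G a u = word_val G a v"
proof -
  have cancel: "letter_val G a x \<otimes> (letter_val G a (letter_inv x) \<otimes> y) = y"
    if "y \<in> carrier G" for x y
    using that a by (cases x) (simp_all flip: m_assoc)
  have step: "word_val G a u = word_val G a v" if "cancel_step u v" for u v
    using that
    by cases (simp add: word_val_append a word_val_closed cancel)
  show ?thesis
    using eq unfolding free_eq_def
    by (induction rule: equivclp_induct) (auto dest: step)
qed

lemma (in group) word_val_well_defined: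
  assumes a: "a \<in> tuples G n" and u: "u \<in> words n" and v: "v \<in> words n" and eq: "free_eq u v"
  shows "word_val G a u = word_val G a v"
proof -
  define a' where "a' i = (if i \<in> {1..n} then a i else \<one>)" for i
  have a': "a' i \<in> carrier G" for i
    using a by (auto simp: a'_def tuples_def)
  have lv: "letter_val G a x = letter_val G a' x" if "letter_index x \<in> {1..n}" for x
    using that by (cases x) (auto simp: a'_def)
  have wv: "word_val G a w = word_val G a' w" if "w \<in> words n" for w
    using that by (induction w) (auto simp: words_def lv)
  show ?thesis
    using word_val_free_eq[OF a' eq] by (simp add: wv u v)
qed

end

theory Submission
  imports Defs "HOL-Library.Multiset"
begin

text \<open>The argument needs no character theory. Let \<open>T\<close> (\<open>comm_avg\<close> below) send a real function
  \<open>\<phi>\<close> on \<open>G\<close> to the function whose value at \<open>g\<close> is the average of \<open>\<phi> (g x y x\<^sup>-\<^sup>1 y\<^sup>-\<^sup>1)\<close>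
  over all \<open>x, y\<close>, and let \<open>\<delta>\<close> be the indicator function of the identity. The proof has two
  independent halves.

  On the combinatorial side, the distribution of an admissible word is \<open>T\<^sup>k \<delta>\<close> for some \<open>k\<close>, with
  \<open>k > 0\<close> if the word is nontrivial (\<open>Pr_word_eq_comm_pow\<close>). A nonempty admissible word has either
  two adjacent inverse letters, which can be cancelled, or two interleaved pairs
  \<open>X \<dots> Y \<dots> X\<^sup>-\<^sup>1 \<dots> Y\<^sup>-\<^sup>1\<close> (\<open>admissible_cases\<close>). In the second case the substitution
  \<open>X \<mapsto> t X v\<^sub>2\<close> turns \<open>u X v\<^sub>1 v\<^sub>2 X\<^sup>-\<^sup>1 t\<close> into \<open>u t X v\<^sub>2 v\<^sub>1 X\<^sup>-\<^sup>1\<close> without changing the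
  distribution (\<open>Pr_word_move\<close>), and three such moves collect \<open>X, Y\<close> into a commutator
  at the end of the word. Its variables are independent of the rest, so this commutator contributes
  one application of \<open>T\<close> (\<open>Pr_word_commutator\<close>).

  On the analytic side, \<open>T\<close> preserves the symmetric, strictly positive definite class functions,
  and \<open>\<delta>\<close> is one of them. The reason is that \<open>x y x\<^sup>-\<^sup>1 y\<^sup>-\<^sup>1\<close> has the same distribution as
  \<open>a b\<^sup>-\<^sup>1\<close> with \<open>a, b\<close> independent random conjugates of one random element, so that the quadratic
  form of \<open>T \<phi>\<close> is a sum of values of the quadratic form of \<open>\<phi>\<close> (\<open>quad_form_comm_avg\<close>). A symmetric,
  strictly positive definite function satisfies \<open>\<phi> g < \<phi> 1\<close> for \<open>g \<noteq> 1\<close>: evaluate the form at the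
  difference of the point masses at \<open>1\<close> and \<open>g\<close>. This gives the first inequality and the equality
  case. It also shows that \<open>T \<phi> 1 \<le> \<phi> 1\<close>, hence \<open>T\<^sup>k \<delta> 1 \<le> T \<delta> 1\<close> for \<open>k > 0\<close>, and
  \<open>T \<delta> 1\<close> is the commuting probability.\<close>

section \<open>Averaging over commutators\<close>

text \<open>Right convolution with the (inversion-invariant) distribution of a random commutator.\<close>

definition comm_avg :: "('a, 'b) monoid_scheme \<Rightarrow> ('a \<Rightarrow> real) \<Rightarrow> 'a \<Rightarrow> real" where
  "comm_avg G \<phi> g =
     (\<Sum>x\<in>carrier G. \<Sum>y\<in>carrier G.
        \<phi> (g \<otimes>\<^bsub>G\<^esub> (x \<otimes>\<^bsub>G\<^esub> y \<otimes>\<^bsub>G\<^esub> inv\<^bsub>G\<^esub> x \<otimes>\<^bsub>G\<^esub> inv\<^bsub>G\<^esub> y))) / (real (order G))\<^sup>2"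

text \<open>Invariance under cyclic exchange of a product, which on the carrier of a group is equivalent to
  being constant on conjugacy classes.\<close>

definition class_fun :: "('a, 'b) monoid_scheme \<Rightarrow> ('a \<Rightarrow> real) \<Rightarrow> bool" where
  "class_fun G \<phi> \<longleftrightarrow>
     (\<forall>x\<in>carrier G. \<forall>y\<in>carrier G. \<phi> (x \<otimes>\<^bsub>G\<^esub> y) = \<phi> (y \<otimes>\<^bsub>G\<^esub> x))"

text \<open>Functions invariant under inversion.\<close>

definition symmetric_fun :: "('a, 'b) monoid_scheme \<Rightarrow> ('a \<Rightarrow> real) \<Rightarrow> bool" where
  "symmetric_fun G \<phi> \<longleftrightarrow> (\<forall>x\<in>carrier G. \<phi> (inv\<^bsub>G\<^esub> x) = \<phi> x)"

text \<open>The quadratic form with matrix \<open>\<phi> (p\<^sup>-\<^sup>1 q)\<close>, indexed by group elements, evaluated at the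
  vector \<open>c\<close>.\<close>

definition quad_form :: "('a, 'b) monoid_scheme \<Rightarrow> ('a \<Rightarrow> real) \<Rightarrow> ('a \<Rightarrow> real) \<Rightarrow> real" where
  "quad_form G \<phi> c =
     (\<Sum>p\<in>carrier G. \<Sum>q\<in>carrier G. c p * c q * \<phi> (inv\<^bsub>G\<^esub> p \<otimes>\<^bsub>G\<^esub> q))"

text \<open>Vectors \<open>c\<close> are total functions, but only their values on the carrier matter.\<close>

definition strictly_pos_def :: "('a, 'b) monoid_scheme \<Rightarrow> ('a \<Rightarrow> real) \<Rightarrow> bool" where
  "strictly_pos_def G \<phi> \<longleftrightarrow> (\<forall>c. (\<exists>p\<in>carrier G. c p \<noteq> 0) \<longrightarrow> quad_form G \<phi> c > 0)"

locale fin_group = group +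
  assumes fin: "finite (carrier G)"
begin

lemma inv_cancel_left:
  assumes "x \<in> carrier G" "y \<in> carrier G"
  shows "x \<otimes> (inv x \<otimes> y) = y" "inv x \<otimes> (x \<otimes> y) = y"
  using assms by (simp_all flip: m_assoc)

lemmas group_word_simps = m_assoc inv_mult_group inv_cancel_left

lemma order_pos: "real (order G) > 0"
  using order_gt_0_iff_finite fin by simp

lemma sum_translate:
  fixes f :: "'a \<Rightarrow> real"
  assumes "s \<in> carrier G" "r \<in> carrier G"
  shows "(\<Sum>x\<in>carrier G. f (s \<otimes> x \<otimes> r)) = (\<Sum>x\<in>carrier G. f x)"
  by (rule sum.reindex_bij_witness[where i = "\<lambda>x. inv s \<otimes> x \<otimes> inv r" and j = "\<lambda>x. s \<otimes> x \<otimes> r"])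
     (use assms in \<open>auto simp: group_word_simps\<close>)

lemma class_funD:
  "class_fun G \<phi> \<Longrightarrow> x \<in> carrier G \<Longrightarrow> y \<in> carrier G \<Longrightarrow> \<phi> (x \<otimes> y) = \<phi> (y \<otimes> x)"
  by (auto simp: class_fun_def)

lemma class_fun_comm_avg:
  assumes \<phi>: "class_fun G \<phi>"
  shows "class_fun G (comm_avg G \<phi>)"
  unfolding class_fun_def
proof (intro ballI)
  fix a b assume a: "a \<in> carrier G" and b: "b \<in> carrier G"
  let ?k = "\<lambda>x y. x \<otimes> y \<otimes> inv x \<otimes> inv y"
  let ?c = "\<lambda>x. a \<otimes> x \<otimes> inv a"
  have "(\<Sum>x\<in>carrier G. \<Sum>y\<in>carrier G. \<phi> (a \<otimes> b \<otimes> ?k x y))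
      = (\<Sum>x\<in>carrier G. \<Sum>y\<in>carrier G. \<phi> (b \<otimes> ?k x y \<otimes> a))"
    using class_funD[OF \<phi> a] a b by (intro sum.cong refl) (simp add: m_assoc)
  \<comment> \<open>Conjugating both variables by \<open>a\<close> moves \<open>a\<close> across the commutator.\<close>
  also have "\<dots> = (\<Sum>x\<in>carrier G. \<Sum>y\<in>carrier G. \<phi> (b \<otimes> ?k x (?c y) \<otimes> a))"
    by (rule sum.cong[OF refl], rule sum_translate[OF a inv_closed[OF a], symmetric])
  also have "\<dots> = (\<Sum>x\<in>carrier G. \<Sum>y\<in>carrier G. \<phi> (b \<otimes> ?k (?c x) (?c y) \<otimes> a))"
    using sum_translate[OF a inv_closed[OF a],
        of "\<lambda>x. \<Sum>y\<in>carrier G. \<phi> (b \<otimes> ?k x (?c y) \<otimes> a)"] by simp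
  also have "\<dots> = (\<Sum>x\<in>carrier G. \<Sum>y\<in>carrier G. \<phi> (b \<otimes> a \<otimes> ?k x y))"
    using a b by (intro sum.cong refl) (simp add: group_word_simps)
  finally show "comm_avg G \<phi> (a \<otimes> b) = comm_avg G \<phi> (b \<otimes> a)"
    by (simp add: comm_avg_def)
qed

lemma symmetric_fun_comm_avg:
  assumes \<phi>: "class_fun G \<phi>" and sym: "symmetric_fun G \<phi>"
  shows "symmetric_fun G (comm_avg G \<phi>)"
  unfolding symmetric_fun_def
proof
  fix g assume g: "g \<in> carrier G"
  let ?k = "\<lambda>x y. x \<otimes> y \<otimes> inv x \<otimes> inv y"
  have "\<phi> (inv g \<otimes> ?k x y) = \<phi> (g \<otimes> ?k y x)" if "x \<in> carrier G" "y \<in> carrier G" for x y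
  proof -
    have "\<phi> (inv g \<otimes> ?k x y) = \<phi> (inv (inv g \<otimes> ?k x y))"
      using sym g that by (simp add: symmetric_fun_def)
    also have "inv (inv g \<otimes> ?k x y) = ?k y x \<otimes> g"
      using g that by (simp add: group_word_simps)
    also have "\<phi> \<dots> = \<phi> (g \<otimes> ?k y x)"
      using class_funD[OF \<phi>, of "?k y x" g] g that by simp
    finally show ?thesis .
  qed
  then have "(\<Sum>x\<in>carrier G. \<Sum>y\<in>carrier G. \<phi> (inv g \<otimes> ?k x y))
      = (\<Sum>x\<in>carrier G. \<Sum>y\<in>carrier G. \<phi> (g \<otimes> ?k y x))"
    by simp
  also have "\<dots> = (\<Sum>x\<in>carrier G. \<Sum>y\<in>carrier G. \<phi> (g \<otimes> ?k x y))"
    by (rule sum.swap)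
  finally show "comm_avg G \<phi> (inv g) = comm_avg G \<phi> g"
    by (simp add: comm_avg_def)
qed

text \<open>Replacing \<open>y\<close> by \<open>w z w\<^sup>-\<^sup>1\<close> and \<open>x\<close> by \<open>x w\<^sup>-\<^sup>1\<close> turns the commutator of \<open>x\<close> and \<open>y\<close> into
  \<open>(x z x\<^sup>-\<^sup>1) (w z w\<^sup>-\<^sup>1)\<^sup>-\<^sup>1\<close>. For a class function the two conjugates of \<open>z\<close> can be absorbed into \<open>q\<close> and
  \<open>p\<close> separately, which makes the form a sum over \<open>z\<close> of values of the form of \<open>\<phi>\<close>.\<close>

lemma quad_form_comm_avg:
  assumes \<phi>: "class_fun G \<phi>"
  shows "real (order G) ^ 3 * quad_form G (comm_avg G \<phi>) c
       = (\<Sum>z\<in>carrier G. quad_form G \<phi> (\<lambda>p. \<Sum>w\<in>carrier G. c (p \<otimes> (w \<otimes> inv z \<otimes> inv w))))"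
proof -
  let ?S = "carrier G" and ?N = "real (order G)"
  have avg: "?N ^ 3 * comm_avg G \<phi> (inv p \<otimes> q)
      = (\<Sum>z\<in>?S. \<Sum>w\<in>?S. \<Sum>x\<in>?S.
           \<phi> (inv (p \<otimes> (w \<otimes> z \<otimes> inv w)) \<otimes> (q \<otimes> (x \<otimes> z \<otimes> inv x))))"
    if p: "p \<in> ?S" and q: "q \<in> ?S" for p q
  proof -
    let ?F = "\<lambda>x y. \<phi> (inv p \<otimes> q \<otimes> (x \<otimes> y \<otimes> inv x \<otimes> inv y))"
    have "?N ^ 3 * comm_avg G \<phi> (inv p \<otimes> q) = (\<Sum>w\<in>?S. \<Sum>x\<in>?S. \<Sum>y\<in>?S. ?F x y)"
      using order_pos by (simp add: comm_avg_def power3_eq_cube power2_eq_square order_def)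
    also have "\<dots> = (\<Sum>w\<in>?S. \<Sum>y\<in>?S. \<Sum>x\<in>?S. ?F x y)"
      by (intro sum.cong refl sum.swap)
    also have "\<dots> = (\<Sum>w\<in>?S. \<Sum>z\<in>?S. \<Sum>x\<in>?S. ?F x (w \<otimes> z \<otimes> inv w))"
      by (rule sum.cong[OF refl], rule sum_translate[symmetric]) auto
    also have "\<dots> = (\<Sum>w\<in>?S. \<Sum>z\<in>?S. \<Sum>x\<in>?S. ?F (\<one> \<otimes> x \<otimes> inv w) (w \<otimes> z \<otimes> inv w))"
      by (rule sum.cong[OF refl], rule sum.cong[OF refl], rule sum_translate[symmetric]) auto
    also have "\<dots> = (\<Sum>w\<in>?S. \<Sum>z\<in>?S. \<Sum>x\<in>?S.
           \<phi> (inv (p \<otimes> (w \<otimes> z \<otimes> inv w)) \<otimes> (q \<otimes> (x \<otimes> z \<otimes> inv x))))"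
    proof (intro sum.cong refl)
      fix w z x assume "w \<in> ?S" "z \<in> ?S" "x \<in> ?S"
      then show "?F (\<one> \<otimes> x \<otimes> inv w) (w \<otimes> z \<otimes> inv w)
          = \<phi> (inv (p \<otimes> (w \<otimes> z \<otimes> inv w)) \<otimes> (q \<otimes> (x \<otimes> z \<otimes> inv x)))"
        using class_funD[OF \<phi>, of "inv p \<otimes> q \<otimes> (x \<otimes> z \<otimes> inv x)" "w \<otimes> inv z \<otimes> inv w"] p q
        by (simp add: group_word_simps)
    qed
    also have "\<dots> = (\<Sum>z\<in>?S. \<Sum>w\<in>?S. \<Sum>x\<in>?S.
           \<phi> (inv (p \<otimes> (w \<otimes> z \<otimes> inv w)) \<otimes> (q \<otimes> (x \<otimes> z \<otimes> inv x))))"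
      by (rule sum.swap)
    finally show ?thesis .
  qed
  \<comment> \<open>Translating \<open>p\<close> transfers the conjugate of \<open>z\<close> from the argument of \<open>f\<close> to that of \<open>c\<close>.\<close>
  have shift: "(\<Sum>p\<in>?S. \<Sum>w\<in>?S. c p * f (p \<otimes> (w \<otimes> z \<otimes> inv w)))
      = (\<Sum>p\<in>?S. (\<Sum>w\<in>?S. c (p \<otimes> (w \<otimes> inv z \<otimes> inv w))) * f p)"
    if z: "z \<in> ?S" for z and f :: "'a \<Rightarrow> real"
  proof -
    have "(\<Sum>p\<in>?S. \<Sum>w\<in>?S. c p * f (p \<otimes> (w \<otimes> z \<otimes> inv w)))
        = (\<Sum>w\<in>?S. \<Sum>p\<in>?S. c p * f (p \<otimes> (w \<otimes> z \<otimes> inv w)))"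
      by (rule sum.swap)
    also have "\<dots> = (\<Sum>w\<in>?S. \<Sum>p\<in>?S. c (p \<otimes> (w \<otimes> inv z \<otimes> inv w)) * f p)"
    proof (rule sum.cong[OF refl])
      fix w assume w: "w \<in> ?S"
      let ?h = "\<lambda>p. c p * f (p \<otimes> (w \<otimes> z \<otimes> inv w))"
      have "(\<Sum>p\<in>?S. ?h p) = (\<Sum>p\<in>?S. ?h (\<one> \<otimes> p \<otimes> (w \<otimes> inv z \<otimes> inv w)))"
        using w z by (intro sum_translate[symmetric]) auto
      also have "\<dots> = (\<Sum>p\<in>?S. c (p \<otimes> (w \<otimes> inv z \<otimes> inv w)) * f p)"
        using w z by (intro sum.cong refl) (simp add: group_word_simps)
      finally show "(\<Sum>p\<in>?S. ?h p) = (\<Sum>p\<in>?S. c (p \<otimes> (w \<otimes> inv z \<otimes> inv w)) * f p)" .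
    qed
    also have "\<dots> = (\<Sum>p\<in>?S. \<Sum>w\<in>?S. c (p \<otimes> (w \<otimes> inv z \<otimes> inv w)) * f p)"
      by (rule sum.swap)
    finally show ?thesis
      by (simp add: sum_distrib_right)
  qed
  have "?N ^ 3 * quad_form G (comm_avg G \<phi>) c
      = (\<Sum>p\<in>?S. \<Sum>q\<in>?S. c p * c q * (?N ^ 3 * comm_avg G \<phi> (inv p \<otimes> q)))"
    by (simp add: quad_form_def sum_distrib_left mult_ac)
  also have "\<dots> = (\<Sum>p\<in>?S. \<Sum>q\<in>?S. \<Sum>z\<in>?S. \<Sum>w\<in>?S. \<Sum>x\<in>?S.
       c p * (c q * \<phi> (inv (p \<otimes> (w \<otimes> z \<otimes> inv w)) \<otimes> (q \<otimes> (x \<otimes> z \<otimes> inv x)))))"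
    by (intro sum.cong refl) (simp add: avg sum_distrib_left mult.assoc)
  also have "\<dots> = (\<Sum>p\<in>?S. \<Sum>z\<in>?S. \<Sum>q\<in>?S. \<Sum>w\<in>?S. \<Sum>x\<in>?S.
       c p * (c q * \<phi> (inv (p \<otimes> (w \<otimes> z \<otimes> inv w)) \<otimes> (q \<otimes> (x \<otimes> z \<otimes> inv x)))))"
    by (intro sum.cong refl sum.swap)
  also have "\<dots> = (\<Sum>z\<in>?S. \<Sum>p\<in>?S. \<Sum>q\<in>?S. \<Sum>w\<in>?S. \<Sum>x\<in>?S.
       c p * (c q * \<phi> (inv (p \<otimes> (w \<otimes> z \<otimes> inv w)) \<otimes> (q \<otimes> (x \<otimes> z \<otimes> inv x)))))"
    by (rule sum.swap)
  also have "\<dots> = (\<Sum>z\<in>?S. \<Sum>p\<in>?S. \<Sum>w\<in>?S. \<Sum>q\<in>?S. \<Sum>x\<in>?S.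
       c p * (c q * \<phi> (inv (p \<otimes> (w \<otimes> z \<otimes> inv w)) \<otimes> (q \<otimes> (x \<otimes> z \<otimes> inv x)))))"
    by (intro sum.cong refl sum.swap)
  also have "\<dots> = (\<Sum>z\<in>?S. \<Sum>p\<in>?S. \<Sum>w\<in>?S. c p *
       (\<Sum>q\<in>?S. \<Sum>x\<in>?S. c q * \<phi> (inv (p \<otimes> (w \<otimes> z \<otimes> inv w)) \<otimes> (q \<otimes> (x \<otimes> z \<otimes> inv x)))))"
    by (simp add: sum_distrib_left)
  also have "\<dots> = (\<Sum>z\<in>?S. quad_form G \<phi> (\<lambda>p. \<Sum>w\<in>?S. c (p \<otimes> (w \<otimes> inv z \<otimes> inv w))))"
  proof (rule sum.cong[OF refl])
    fix z assume z: "z \<in> ?S"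
    define d where "d p = (\<Sum>w\<in>?S. c (p \<otimes> (w \<otimes> inv z \<otimes> inv w)))" for p
    note shift_z = shift[OF z, folded d_def]
    have "(\<Sum>p\<in>?S. \<Sum>w\<in>?S. c p *
       (\<Sum>q\<in>?S. \<Sum>x\<in>?S. c q * \<phi> (inv (p \<otimes> (w \<otimes> z \<otimes> inv w)) \<otimes> (q \<otimes> (x \<otimes> z \<otimes> inv x)))))
      = (\<Sum>p\<in>?S. d p * (\<Sum>q\<in>?S. \<Sum>x\<in>?S. c q * \<phi> (inv p \<otimes> (q \<otimes> (x \<otimes> z \<otimes> inv x)))))"
      by (rule shift_z[of "\<lambda>p. \<Sum>q\<in>?S. \<Sum>x\<in>?S. c q * \<phi> (inv p \<otimes> (q \<otimes> (x \<otimes> z \<otimes> inv x)))"])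
    also have "\<dots> = (\<Sum>p\<in>?S. d p * (\<Sum>q\<in>?S. d q * \<phi> (inv p \<otimes> q)))"
      by (intro sum.cong refl arg_cong2[where f = "(*)"] shift_z)
    also have "\<dots> = quad_form G \<phi> d"
      by (simp add: quad_form_def sum_distrib_left mult.assoc)
    finally show "(\<Sum>p\<in>?S. \<Sum>w\<in>?S. c p *
       (\<Sum>q\<in>?S. \<Sum>x\<in>?S. c q * \<phi> (inv (p \<otimes> (w \<otimes> z \<otimes> inv w)) \<otimes> (q \<otimes> (x \<otimes> z \<otimes> inv x)))))
      = quad_form G \<phi> (\<lambda>p. \<Sum>w\<in>?S. c (p \<otimes> (w \<otimes> inv z \<otimes> inv w)))"
      unfolding d_def .
  qed
  finally show ?thesis .
qed

lemma strictly_pos_def_nonneg: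
  assumes "strictly_pos_def G \<phi>"
  shows "quad_form G \<phi> c \<ge> 0"
proof (cases "\<exists>p\<in>carrier G. c p \<noteq> 0")
  case True
  then have "quad_form G \<phi> c > 0"
    using assms unfolding strictly_pos_def_def by blast
  then show ?thesis by simp
next
  case False
  then show ?thesis by (simp add: quad_form_def)
qed

text \<open>In the sum over \<open>z\<close> all terms are nonnegative, and the term for \<open>z = 1\<close>, in which \<open>c\<close> is merely
  scaled by the order of \<open>G\<close>, is positive.\<close>

lemma strictly_pos_def_comm_avg:
  assumes \<phi>: "class_fun G \<phi>" and pd: "strictly_pos_def G \<phi>"
  shows "strictly_pos_def G (comm_avg G \<phi>)"
  unfolding strictly_pos_def_def
proof (intro allI impI)
  fix c :: "'a \<Rightarrow> real" assume c: "\<exists>p\<in>carrier G. c p \<noteq> 0"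
  let ?d = "\<lambda>z p. \<Sum>w\<in>carrier G. c (p \<otimes> (w \<otimes> inv z \<otimes> inv w))"
  have "?d \<one> p = real (order G) * c p" if "p \<in> carrier G" for p
    using that by (simp add: order_def)
  moreover obtain p where "p \<in> carrier G" "c p \<noteq> 0"
    using c by blast
  ultimately have "p \<in> carrier G \<and> ?d \<one> p \<noteq> 0"
    using order_pos by (simp add: order_def)
  then have "quad_form G \<phi> (?d \<one>) > 0"
    using pd[unfolded strictly_pos_def_def, rule_format, of "?d \<one>"] by blast
  also have "quad_form G \<phi> (?d \<one>) \<le> (\<Sum>z\<in>carrier G. quad_form G \<phi> (?d z))"
    by (rule member_le_sum) (use fin strictly_pos_def_nonneg[OF pd] in auto)
  also have "\<dots> = real (order G) ^ 3 * quad_form G (comm_avg G \<phi>) c"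
    by (rule quad_form_comm_avg[OF \<phi>, symmetric])
  finally show "quad_form G (comm_avg G \<phi>) c > 0"
    using order_pos by (simp add: zero_less_mult_iff)
qed

lemma strictly_pos_def_less_one:
  assumes pd: "strictly_pos_def G \<phi>" and sym: "symmetric_fun G \<phi>"
    and g: "g \<in> carrier G" "g \<noteq> \<one>"
  shows "\<phi> g < \<phi> \<one>"
proof -
  define c :: "'a \<Rightarrow> real" where "c p = (if p = \<one> then 1 else 0) - (if p = g then 1 else 0)" for p
  have sum_c: "(\<Sum>p\<in>carrier G. c p * f p) = f \<one> - f g" for f
  proof -
    have "c p * f p = (if p = \<one> then f p else 0) - (if p = g then f p else 0)" for p
      by (simp add: c_def)
    then show ?thesis
      using g fin by (simp add: sum_subtractf)
  qed
  have "quad_form G \<phi> c = (\<Sum>p\<in>carrier G. c p * (\<Sum>q\<in>carrier G. c q * \<phi> (inv p \<otimes> q)))"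
    by (simp add: quad_form_def sum_distrib_left mult.assoc)
  also have "\<dots> = 2 * (\<phi> \<one> - \<phi> g)"
    using g sym by (simp add: sum_c symmetric_fun_def)
  finally have "quad_form G \<phi> c = 2 * (\<phi> \<one> - \<phi> g)" .
  moreover have "c \<one> \<noteq> 0"
    using g by (simp add: c_def)
  then have "quad_form G \<phi> c > 0"
    using pd[unfolded strictly_pos_def_def, rule_format, of c] one_closed by blast
  ultimately show ?thesis by simp
qed

text \<open>The distribution of a product of \<open>k\<close> independent random commutators.\<close>

definition comm_pow :: "nat \<Rightarrow> 'a \<Rightarrow> real" where
  "comm_pow k = (comm_avg G ^^ k) (\<lambda>g. if g = \<one> then 1 else 0)"

lemma comm_pow_Suc: "comm_pow (Suc k) = comm_avg G (comm_pow k)"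
  by (simp add: comm_pow_def)

lemma comm_pow_invariants:
  "class_fun G (comm_pow k) \<and> symmetric_fun G (comm_pow k) \<and> strictly_pos_def G (comm_pow k)"
proof (induction k)
  case 0
  let ?\<delta> = "comm_pow 0"
  have "x \<otimes> y = \<one> \<longleftrightarrow> y \<otimes> x = \<one>" if "x \<in> carrier G" "y \<in> carrier G" for x y
    using that by (metis inv_comm)
  then have "class_fun G ?\<delta>"
    by (simp add: class_fun_def comm_pow_def)
  moreover have "symmetric_fun G ?\<delta>"
    by (auto simp: symmetric_fun_def comm_pow_def inv_eq_1_iff)
  moreover have "strictly_pos_def G ?\<delta>"
    unfolding strictly_pos_def_def
  proof (intro allI impI)
    fix c :: "'a \<Rightarrow> real" assume "\<exists>p\<in>carrier G. c p \<noteq> 0"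
    then obtain p0 where p0: "p0 \<in> carrier G" "c p0 \<noteq> 0" by blast
    have "inv p \<otimes> q = \<one> \<longleftrightarrow> q = p" if "p \<in> carrier G" "q \<in> carrier G" for p q
      using inv_cancel_left(1)[OF that] that by auto
    then have "quad_form G ?\<delta> c = (\<Sum>p\<in>carrier G. \<Sum>q\<in>carrier G. if q = p then c p * c q else 0)"
      unfolding quad_form_def comm_pow_def by (intro sum.cong refl) auto
    also have "\<dots> = (\<Sum>p\<in>carrier G. c p * c p)"
      using fin by simp
    also have "\<dots> > 0"
      using p0 fin by (intro sum_pos2[of _ p0]) (auto simp: zero_less_mult_iff)
    finally show "quad_form G ?\<delta> c > 0" .
  qed
  ultimately show ?case by blast
next
  case (Suc k)
  then show ?case
    by (simp add: comm_pow_Suc class_fun_comm_avg symmetric_fun_comm_avg strictly_pos_def_comm_avg)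
qed

lemma comm_pow_less_one:
  assumes "g \<in> carrier G" "g \<noteq> \<one>"
  shows "comm_pow k g < comm_pow k \<one>"
  using comm_pow_invariants[of k] assms by (intro strictly_pos_def_less_one) auto

lemma comm_pow_le_one: "g \<in> carrier G \<Longrightarrow> comm_pow k g \<le> comm_pow k \<one>"
  using comm_pow_less_one[of g k] by (cases "g = \<one>") auto

lemma comm_pow_one_Suc_le: "comm_pow (Suc k) \<one> \<le> comm_pow k \<one>"
proof -
  have "comm_pow (Suc k) \<one>
      \<le> (\<Sum>x\<in>carrier G. \<Sum>y\<in>carrier G. comm_pow k \<one>) / (real (order G))\<^sup>2"
    unfolding comm_pow_Suc comm_avg_def
    by (intro divide_right_mono sum_mono comm_pow_le_one) auto
  also have "\<dots> = comm_pow k \<one>"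
    using order_pos by (simp add: order_def power2_eq_square)
  finally show ?thesis .
qed

lemma comm_pow_1_one: "comm_pow 1 \<one> = Pr_comm G"
proof -
  let ?S = "carrier G"
  have *: "x \<otimes> y \<otimes> inv x \<otimes> inv y = \<one> \<longleftrightarrow> x \<otimes> y = y \<otimes> x" if "x \<in> ?S" "y \<in> ?S" for x y
  proof -
    have "x \<otimes> y \<otimes> inv x \<otimes> inv y = (x \<otimes> y) \<otimes> inv (y \<otimes> x)"
      using that by (simp add: group_word_simps)
    moreover have "x \<otimes> y \<otimes> inv (y \<otimes> x) \<otimes> (y \<otimes> x) = x \<otimes> y"
      using that by (simp add: group_word_simps)
    ultimately show ?thesis
      using that by auto
  qed
  have "(\<Sum>x\<in>?S. \<Sum>y\<in>?S. if \<one> \<otimes> (x \<otimes> y \<otimes> inv x \<otimes> inv y) = \<one> then 1 else (0::real))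
      = (\<Sum>x\<in>?S. \<Sum>y\<in>?S. if x \<otimes> y = y \<otimes> x then 1 else 0)"
    by (intro sum.cong refl) (simp add: *)
  also have "\<dots> = (\<Sum>(x, y)\<in>?S \<times> ?S. if x \<otimes> y = y \<otimes> x then 1 else 0)"
    by (simp add: sum.cartesian_product)
  also have "\<dots> = real (card {p \<in> ?S \<times> ?S. fst p \<otimes> snd p = snd p \<otimes> fst p})"
    using fin by (simp add: case_prod_beta flip: sum.inter_filter)
  also have "{p \<in> ?S \<times> ?S. fst p \<otimes> snd p = snd p \<otimes> fst p}
      = {(x, y). x \<in> ?S \<and> y \<in> ?S \<and> x \<otimes> y = y \<otimes> x}"
    by auto
  finally show ?thesis
    by (simp add: comm_pow_def comm_avg_def Pr_comm_def)
qed

lemma comm_pow_Suc_one_le: "comm_pow (Suc k) \<one> \<le> Pr_comm G"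
proof (induction k)
  case 0
  then show ?case using comm_pow_1_one by simp
next
  case (Suc k)
  then show ?case using comm_pow_one_Suc_le[of "Suc k"] by simp
qed

section \<open>Substitution in one variable\<close>

lemma finite_tuples: "finite (tuples G n)"
  unfolding tuples_def using fin by (intro finite_PiE) auto

lemma tuples_nth: "a \<in> tuples G n \<Longrightarrow> i \<in> {1..n} \<Longrightarrow> a i \<in> carrier G"
  by (auto simp: tuples_def)

lemma tuples_upd:
  "a \<in> tuples G n \<Longrightarrow> i \<in> {1..n} \<Longrightarrow> h \<in> carrier G \<Longrightarrow> a(i := h) \<in> tuples G n"
  unfolding tuples_def by (rule PiE_I) (auto simp: PiE_iff extensional_def)

lemma letter_val_tuples:
  "a \<in> tuples G n \<Longrightarrow> letter_index x \<in> {1..n} \<Longrightarrow> letter_val G a x \<in> carrier G"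
  by (rule letter_val_closed) (rule tuples_nth)

lemma word_val_tuples:
  "a \<in> tuples G n \<Longrightarrow> w \<in> words n \<Longrightarrow> word_val G a w \<in> carrier G"
  by (induction w) (auto simp: words_def letter_val_tuples)

lemma word_val_append_tuples:
  "a \<in> tuples G n \<Longrightarrow> u \<in> words n \<Longrightarrow> v \<in> words n \<Longrightarrow>
     word_val G a (u @ v) = word_val G a u \<otimes> word_val G a v"
proof (induction u)
  case Nil
  then show ?case by (simp add: word_val_tuples)
next
  case (Cons x u)
  then have "u \<in> words n" "letter_index x \<in> {1..n}" by (auto simp: words_def)
  with Cons show ?case by (simp add: m_assoc word_val_tuples letter_val_tuples)
qed

lemma letter_val_inv:
  "a (letter_index x) \<in> carrier G \<Longrightarrow> letter_val G a (letter_inv x) = inv (letter_val G a x)"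
  by (cases x) auto

lemma word_val_upd:
  "i \<notin> letter_index ` set w \<Longrightarrow> word_val G (a(i := h)) w = word_val G a w"
proof (induction w)
  case (Cons x w)
  then show ?case by (cases x) auto
qed simp

text \<open>If \<open>F\<close> does not depend on one coordinate of the tuple, then averaging \<open>F\<close> with the letter of that
  coordinate as second argument is the same as averaging over a second argument chosen independently.
  The bijection behind it exchanges the coordinate with the additional variable.\<close>

lemma sum_resample:
  fixes F :: "(nat \<Rightarrow> 'a) \<Rightarrow> 'a \<Rightarrow> real"
  assumes X: "letter_index X \<in> {1..n}"
    and indep: "\<And>a h x. F (a(letter_index X := h)) x = F a x"
  shows "real (order G) * (\<Sum>a\<in>tuples G n. F a (letter_val G a X))
       = (\<Sum>a\<in>tuples G n. \<Sum>x\<in>carrier G. F a x)"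
proof -
  let ?i = "letter_index X"
  \<comment> \<open>The involution that converts a coordinate to the value of the letter \<open>X\<close> and back.\<close>
  define e where "e x = (case X of Gen _ \<Rightarrow> x | GenInv _ \<Rightarrow> inv x)" for x
  have e: "e x \<in> carrier G" "e (e x) = x" if "x \<in> carrier G" for x
    using that by (auto simp: e_def split: letter.split)
  have val: "letter_val G a X = e (a ?i)" for a
    by (cases X) (auto simp: e_def)
  define \<tau> where "\<tau> = (\<lambda>(a, x). (a(?i := e x), e (a ?i)))"
  have "real (order G) * (\<Sum>a\<in>tuples G n. F a (letter_val G a X))
      = (\<Sum>(a, x)\<in>tuples G n \<times> carrier G. F a (letter_val G a X))"
    by (simp add: order_def sum_distrib_left flip: sum.cartesian_product)
  also have "\<dots> = (\<Sum>(a, x)\<in>tuples G n \<times> carrier G. F a x)"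
    by (rule sum.reindex_bij_witness[where i = \<tau> and j = \<tau>])
       (use X in \<open>auto simp: \<tau>_def e tuples_upd tuples_nth indep val\<close>)
  finally show ?thesis
    by (simp add: sum.cartesian_product)
qed

lemma Pr_word_eq_sum:
  "Pr_word G n w g
     = (\<Sum>a\<in>tuples G n. if word_val G a w = g then 1 else 0) / real (card (tuples G n))"
  unfolding Pr_word_def using finite_tuples by (simp flip: sum.inter_filter)

text \<open>The substitution \<open>X \<mapsto> t X v\<^sub>2\<close>. It rotates the word between \<open>X\<close> and its inverse and moves what
  follows the inverse in front of \<open>X\<close>.\<close>

lemma Pr_word_move:
  assumes w: "u @ [X] @ v1 @ v2 @ [letter_inv X] @ t \<in> words n"
    and X: "letter_index X \<notin> letter_index ` set (u @ v1 @ v2 @ t)"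
  shows "Pr_word G n (u @ [X] @ v1 @ v2 @ [letter_inv X] @ t) g
       = Pr_word G n (u @ t @ [X] @ v2 @ v1 @ [letter_inv X]) g"
proof -
  have ws: "u \<in> words n" "v1 \<in> words n" "v2 \<in> words n" "t \<in> words n"
      "[X] \<in> words n" "[letter_inv X] \<in> words n" and i: "letter_index X \<in> {1..n}"
    using w by (auto simp: words_def)
  have app: "\<And>p q. p \<in> words n \<Longrightarrow> q \<in> words n \<Longrightarrow> p @ q \<in> words n"
    by (auto simp: words_def)
  have Xs: "letter_index X \<notin> letter_index ` set u" "letter_index X \<notin> letter_index ` set v1"
      "letter_index X \<notin> letter_index ` set v2" "letter_index X \<notin> letter_index ` set t"
    using X by auto
  let ?V = "\<lambda>a. word_val G a"
  define F where "F a x = (if ?V a u \<otimes> (x \<otimes> (?V a v1 \<otimes> (?V a v2 \<otimes> (inv x \<otimes> ?V a t)))) = g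
    then 1 else 0 :: real)" for a x
  define F' where "F' a x = (if ?V a u \<otimes> (?V a t \<otimes> (x \<otimes> (?V a v2 \<otimes> (?V a v1 \<otimes> inv x)))) = g
    then 1 else 0 :: real)" for a x
  have V: "?V a u \<in> carrier G" "?V a v1 \<in> carrier G" "?V a v2 \<in> carrier G" "?V a t \<in> carrier G"
      "letter_val G a X \<in> carrier G" "a (letter_index X) \<in> carrier G" if "a \<in> tuples G n" for a
    using that ws i by (auto intro: word_val_tuples letter_val_tuples tuples_nth)
  have wv: "?V a (u @ [X] @ v1 @ v2 @ [letter_inv X] @ t) = ?V a u \<otimes> (letter_val G a X \<otimes>
        (?V a v1 \<otimes> (?V a v2 \<otimes> (inv (letter_val G a X) \<otimes> ?V a t))))"
      "?V a (u @ t @ [X] @ v2 @ v1 @ [letter_inv X]) = ?V a u \<otimes> (?V a t \<otimes> (letter_val G a X \<otimes>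
        (?V a v2 \<otimes> (?V a v1 \<otimes> inv (letter_val G a X)))))" if a: "a \<in> tuples G n" for a
  proof -
    have "?V a [X] = letter_val G a X" "?V a [letter_inv X] = inv (letter_val G a X)"
      using V[OF a] by (simp_all add: letter_val_inv)
    then show "?V a (u @ [X] @ v1 @ v2 @ [letter_inv X] @ t) = ?V a u \<otimes> (letter_val G a X \<otimes>
        (?V a v1 \<otimes> (?V a v2 \<otimes> (inv (letter_val G a X) \<otimes> ?V a t))))"
      "?V a (u @ t @ [X] @ v2 @ v1 @ [letter_inv X]) = ?V a u \<otimes> (?V a t \<otimes> (letter_val G a X \<otimes>
        (?V a v2 \<otimes> (?V a v1 \<otimes> inv (letter_val G a X)))))"
      by (simp_all only: word_val_append_tuples[OF a] ws app)
  qed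
  have "real (order G) * (\<Sum>a\<in>tuples G n. F a (letter_val G a X))
      = (\<Sum>a\<in>tuples G n. \<Sum>x\<in>carrier G. F a x)"
    by (intro sum_resample[OF i]) (simp add: F_def word_val_upd Xs)
  also have "\<dots> = (\<Sum>a\<in>tuples G n. \<Sum>x\<in>carrier G. F a (?V a t \<otimes> x \<otimes> ?V a v2))"
    by (rule sum.cong[OF refl], rule sum_translate[symmetric]) (auto simp: V)
  also have "\<dots> = (\<Sum>a\<in>tuples G n. \<Sum>x\<in>carrier G. F' a x)"
    by (intro sum.cong refl) (simp add: F_def F'_def V group_word_simps)
  also have "\<dots> = real (order G) * (\<Sum>a\<in>tuples G n. F' a (letter_val G a X))"
    by (intro sum_resample[OF i, symmetric]) (simp add: F'_def word_val_upd Xs)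
  finally have eq: "(\<Sum>a\<in>tuples G n. F a (letter_val G a X)) = (\<Sum>a\<in>tuples G n. F' a (letter_val G a X))"
    using order_pos by simp
  have "Pr_word G n (u @ [X] @ v1 @ v2 @ [letter_inv X] @ t) g
      = (\<Sum>a\<in>tuples G n. F a (letter_val G a X)) / real (card (tuples G n))"
    unfolding Pr_word_eq_sum
    by (rule arg_cong2[where f = "(/)"], rule sum.cong[OF refl], simp only: F_def wv(1), rule refl)
  moreover have "Pr_word G n (u @ t @ [X] @ v2 @ v1 @ [letter_inv X]) g
      = (\<Sum>a\<in>tuples G n. F' a (letter_val G a X)) / real (card (tuples G n))"
    unfolding Pr_word_eq_sum
    by (rule arg_cong2[where f = "(/)"], rule sum.cong[OF refl], simp only: F'_def wv(2), rule refl)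
  ultimately show ?thesis using eq by simp
qed

lemma Pr_word_commutator:
  assumes W: "W \<in> words n" and X: "letter_index X \<in> {1..n}" and Y: "letter_index Y \<in> {1..n}"
    and XY: "letter_index X \<noteq> letter_index Y"
    and "letter_index X \<notin> letter_index ` set W" "letter_index Y \<notin> letter_index ` set W"
    and g: "g \<in> carrier G"
  shows "Pr_word G n (W @ [Y, letter_inv X, letter_inv Y, X]) g
       = comm_avg G (Pr_word G n W) g"
proof -
  let ?T = "tuples G n" and ?S = "carrier G" and ?N = "real (order G)"
  let ?X = "letter_inv X"
  have iX: "letter_index ?X = letter_index X" "letter_inv ?X = X" by (cases X, auto)+
  define F where "F a x y = (if word_val G a W = g \<otimes> (x \<otimes> y \<otimes> inv x \<otimes> inv y)
    then 1 else 0 :: real)" for a x y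
  have upd: "F (a(i := h)) x y = F a x y" if "i = letter_index X \<or> i = letter_index Y" for a i h x y
    using that assms(5,6) by (auto simp: F_def word_val_upd)
  have updY: "letter_val G (a(letter_index X := h)) Y = letter_val G a Y" for a h
    using XY by (cases Y) auto
  have pt: "(if word_val G a (W @ [Y, ?X, letter_inv Y, X]) = g then 1 else 0)
      = F a (letter_val G a ?X) (letter_val G a Y)" if a: "a \<in> ?T" for a
  proof -
    have V: "word_val G a W \<in> ?S" "letter_val G a X \<in> ?S" "letter_val G a Y \<in> ?S"
      "a (letter_index X) \<in> ?S" "a (letter_index Y) \<in> ?S"
      using a W X Y by (auto intro: word_val_tuples letter_val_tuples tuples_nth)
    \<comment> \<open>The appended letters evaluate to the inverse of the commutator of \<open>X\<^sup>-\<^sup>1\<close> and \<open>Y\<close>.\<close>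
    let ?x = "inv (letter_val G a X)" and ?y = "letter_val G a Y"
    have C: "[Y, ?X, letter_inv Y, X] \<in> words n"
      using X Y iX by (cases Y) (auto simp: words_def)
    have "word_val G a (W @ [Y, ?X, letter_inv Y, X])
        = word_val G a W \<otimes> inv (?x \<otimes> ?y \<otimes> inv ?x \<otimes> inv ?y)"
      using V by (simp add: word_val_append_tuples[OF a W C] letter_val_inv group_word_simps)
    moreover have "p \<otimes> inv k = g \<longleftrightarrow> p = g \<otimes> k" if "p \<in> ?S" "k \<in> ?S" for p k
      using that g by (auto simp: group_word_simps)
    ultimately show ?thesis
      using V by (simp add: F_def letter_val_inv del: inv_inv)
  qed
  have "?N\<^sup>2 * (\<Sum>a\<in>?T. if word_val G a (W @ [Y, ?X, letter_inv Y, X]) = g then 1 else 0)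
      = ?N * (?N * (\<Sum>a\<in>?T. F a (letter_val G a ?X) (letter_val G a Y)))"
    by (simp add: pt power2_eq_square)
  also have "?N * (\<Sum>a\<in>?T. F a (letter_val G a ?X) (letter_val G a Y))
      = (\<Sum>a\<in>?T. \<Sum>x\<in>?S. F a x (letter_val G a Y))"
    using X by (intro sum_resample[where F = "\<lambda>a x. F a x (letter_val G a Y)"])
               (simp_all add: iX upd updY)
  also have "?N * \<dots> = (\<Sum>a\<in>?T. \<Sum>y\<in>?S. \<Sum>x\<in>?S. F a x y)"
    using Y by (intro sum_resample[where F = "\<lambda>a y. \<Sum>x\<in>?S. F a x y"]) (simp_all add: upd)
  also have "\<dots> = (\<Sum>a\<in>?T. \<Sum>x\<in>?S. \<Sum>y\<in>?S. F a x y)"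
    by (intro sum.cong refl sum.swap)
  also have "\<dots> = (\<Sum>x\<in>?S. \<Sum>a\<in>?T. \<Sum>y\<in>?S. F a x y)"
    by (rule sum.swap)
  also have "\<dots> = (\<Sum>x\<in>?S. \<Sum>y\<in>?S. \<Sum>a\<in>?T. F a x y)"
    by (intro sum.cong refl sum.swap)
  finally have "(\<Sum>a\<in>?T. if word_val G a (W @ [Y, ?X, letter_inv Y, X]) = g then 1 else 0)
      = (\<Sum>x\<in>?S. \<Sum>y\<in>?S. \<Sum>a\<in>?T. F a x y) / ?N\<^sup>2"
    using order_pos by (simp add: field_simps)
  then show ?thesis
    unfolding comm_avg_def Pr_word_eq_sum F_def
    by (simp add: sum_divide_distrib mult.commute)
qed

end

section \<open>Admissible words\<close>

lemma letter_inv_inv [simp]: "letter_inv (letter_inv X) = X"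
  by (cases X) auto

lemma letter_index_inv [simp]: "letter_index (letter_inv X) = letter_index X"
  by (cases X) auto

lemma letter_inv_neq [simp]: "letter_inv X \<noteq> X" "X \<noteq> letter_inv X"
  by (cases X; simp)+

lemma same_index: "letter_index X = letter_index Y \<Longrightarrow> X = Y \<or> X = letter_inv Y"
  by (cases X; cases Y) auto

lemma admissible_count:
  assumes "admissible w" "X \<in> set w"
  shows "count_list w X = 1" "count_list w (letter_inv X) = 1"
  using assms unfolding admissible_def by (cases X; force)+

lemma admissible_inv_mem:
  assumes "admissible w" "X \<in> set w"
  shows "letter_inv X \<in> set w"
  using admissible_count[OF assms] count_notin[of "letter_inv X" w] by fastforce

lemma admissible_remove_pair:
  assumes w: "admissible w" and ms: "mset w = mset w' + {#X, letter_inv X#}"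
  shows "admissible w'" "letter_index X \<notin> letter_index ` set w'"
proof -
  have cnt: "count_list w l = count_list w' l + (if l = X then 1 else 0) + (if l = letter_inv X then 1 else 0)"
    for l
    using arg_cong[OF ms, of "\<lambda>m. count m l"] by (simp add: count_mset)
  have set: "set w = insert X (insert (letter_inv X) (set w'))"
    using arg_cong[OF ms, of set_mset] by simp
  have "count_list w X = 1" "count_list w (letter_inv X) = 1"
    using admissible_count[OF w, of X] set by auto
  then have "X \<notin> set w'" "letter_inv X \<notin> set w'"
    using cnt[of X] cnt[of "letter_inv X"] by (auto simp: count_list_0_iff)
  then have "letter_index Z \<noteq> letter_index X" if "Z \<in> set w'" for Z
    using that same_index[of Z X] by blast
  then show idx: "letter_index X \<notin> letter_index ` set w'"
    by force
  show "admissible w'"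
    unfolding admissible_def
  proof
    fix i assume i: "i \<in> letter_index ` set w'"
    then have "i \<noteq> letter_index X" using idx by blast
    then have "Gen i \<noteq> X" "Gen i \<noteq> letter_inv X" "GenInv i \<noteq> X" "GenInv i \<noteq> letter_inv X"
      using letter_index_inv[of X] letter_index.simps by metis+
    moreover have "i \<in> letter_index ` set w" using i set by auto
    then have "count_list w (Gen i) = 1 \<and> count_list w (GenInv i) = 1"
      using w unfolding admissible_def by blast
    ultimately show "count_list w' (Gen i) = 1 \<and> count_list w' (GenInv i) = 1"
      using cnt[of "Gen i"] cnt[of "GenInv i"] by simp
  qed
qed

text \<open>Take a letter \<open>X\<close> and its inverse at minimal distance. If they are not adjacent, then the first letter
  \<open>Y\<close> between them has its inverse outside the segment between them, by minimality, so the two pairs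
  interleave. The letters range over generators and inverses, so up to renaming one pattern suffices.\<close>

lemma admissible_cases:
  assumes w: "admissible w" "w \<noteq> []"
  obtains (adjacent) u X v where "w = u @ [X, letter_inv X] @ v"
  | (interleaved) u X A Y B C D where
      "w = u @ [X] @ A @ [Y] @ B @ [letter_inv X] @ C @ [letter_inv Y] @ D"
proof -
  define P where "P A \<longleftrightarrow> (\<exists>u X v. w = u @ [X] @ A @ [letter_inv X] @ v)" for A
  obtain x w0 where x: "w = x # w0" using w by (cases w) auto
  then have "letter_inv x \<in> set w0"
    using admissible_inv_mem[OF w(1), of x] by auto
  then obtain p q where "w0 = p @ letter_inv x # q"
    by (auto simp: in_set_conv_decomp)
  then have "P p"
    unfolding P_def using x by (intro exI[of _ "[]"] exI[of _ x] exI[of _ q]) simp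
  then obtain A where A: "P A" and min: "\<And>B. P B \<Longrightarrow> length A \<le> length B"
    using ex_has_least_nat[of P p length] by blast
  obtain u X v where wA: "w = u @ [X] @ A @ [letter_inv X] @ v"
    using A unfolding P_def by blast
  show ?thesis
  proof (cases A)
    case Nil
    then show ?thesis using wA adjacent by simp
  next
    case (Cons Y A1)
    have "letter_index X \<notin> letter_index ` set (u @ A @ v)"
      by (rule admissible_remove_pair(2)[OF w(1)]) (simp add: wA)
    then have "letter_inv Y \<noteq> X" "letter_inv Y \<noteq> letter_inv X"
      using Cons by (metis letter_index_inv image_eqI in_set_conv_decomp append_Cons append_assoc)+
    moreover have "letter_inv Y \<in> set w"
      by (rule admissible_inv_mem[OF w(1)]) (simp add: wA Cons)
    ultimately consider "letter_inv Y \<in> set u" | "letter_inv Y \<in> set A1" | "letter_inv Y \<in> set v"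
      by (auto simp: wA Cons)
    then show ?thesis
    proof cases
      case 1
      \<comment> \<open>Here \<open>Y\<^sup>-\<^sup>1\<close> comes first and takes the role of \<open>X\<close>.\<close>
      then obtain p q where "u = p @ letter_inv Y # q" by (auto simp: in_set_conv_decomp)
      then show ?thesis
        using interleaved[of p "letter_inv Y" q X "[]" A1 v] wA Cons by simp
    next
      case 2
      then obtain p q where "A1 = p @ letter_inv Y # q" by (auto simp: in_set_conv_decomp)
      then have "w = (u @ [X]) @ [Y] @ p @ [letter_inv Y] @ (q @ [letter_inv X] @ v)"
        using wA Cons by simp
      then have "P p"
        unfolding P_def by blast
      moreover have "length p < length A"
        using Cons \<open>A1 = _\<close> by simp
      ultimately show ?thesis using min[of p] by simp
    next
      case 3
      then obtain p q where "v = p @ letter_inv Y # q" by (auto simp: in_set_conv_decomp)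
      then show ?thesis
        using interleaved[of u X "[]" Y A1 p q] wA Cons by simp
    qed
  qed
qed

lemma free_eq_cancel:
  "free_eq (u @ [X, letter_inv X] @ v) (u @ v)"
  unfolding free_eq_def by (intro r_into_equivclp cancel_step.intros)

lemma nontrivial_cancel:
  assumes "nontrivial_word (u @ [X, letter_inv X] @ v)"
  shows "nontrivial_word (u @ v)"
  using assms equivclp_trans[OF free_eq_cancel[of u X v, unfolded free_eq_def], of "[]"]
  unfolding nontrivial_word_def free_eq_def by blast

section \<open>Distributions of admissible words\<close>

context fin_group
begin

lemma Pr_word_interleaved:
  assumes w: "w = u @ [X] @ A @ [Y] @ B @ [letter_inv X] @ C @ [letter_inv Y] @ D"
    and adm: "admissible w" and wn: "w \<in> words n" and g: "g \<in> carrier G"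
  shows "Pr_word G n w g = comm_avg G (Pr_word G n (u @ C @ B @ A @ D)) g"
proof -
  let ?X = "letter_inv X" and ?Y = "letter_inv Y"
  have X: "letter_index X \<notin> letter_index ` set (u @ A @ [Y] @ B @ C @ [?Y] @ D)"
    by (rule admissible_remove_pair(2)[OF adm]) (simp add: w)
  have Y: "letter_index Y \<notin> letter_index ` set (u @ [X] @ A @ B @ [?X] @ C @ D)"
    by (rule admissible_remove_pair(2)[OF adm]) (simp add: w)
  have "Pr_word G n w g = Pr_word G n (u @ (C @ [?Y] @ D) @ [X] @ ([Y] @ B) @ A @ [?X]) g"
    using Pr_word_move[of u X A "[Y] @ B" "C @ [?Y] @ D" n g] wn X by (auto simp: w)
  also have "\<dots> = Pr_word G n ((u @ C) @ (B @ A @ [?X]) @ [?Y] @ [X] @ D @ [Y]) g"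
    using Pr_word_move[of "u @ C" ?Y D "[X]" "B @ A @ [?X]" n g] wn Y by (auto simp: w words_def)
  also have "\<dots> = Pr_word G n ((u @ C @ B @ A) @ (D @ [Y]) @ [?X] @ [] @ [?Y] @ [X]) g"
    using Pr_word_move[of "u @ C @ B @ A" ?X "[?Y]" "[]" "D @ [Y]" n g] wn X
    by (auto simp: w words_def)
  also have "\<dots> = Pr_word G n ((u @ C @ B @ A @ D) @ [Y, ?X, ?Y, X]) g"
    by simp
  also have "\<dots> = comm_avg G (Pr_word G n (u @ C @ B @ A @ D)) g"
    using wn X Y by (intro Pr_word_commutator g) (auto simp: w words_def)
  finally show ?thesis .
qed

lemma Pr_word_eq_comm_pow:
  assumes "admissible w" "w \<in> words n"
  shows "\<exists>k. (nontrivial_word w \<longrightarrow> k > 0) \<and> (\<forall>g\<in>carrier G. Pr_word G n w g = comm_pow k g)"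
  using assms
proof (induction "length w" arbitrary: w rule: less_induct)
  case less
  show ?case
  proof (cases "w = []")
    case True
    have "tuples G n \<noteq> {}"
      unfolding tuples_def by (auto simp: PiE_eq_empty_iff)
    then have "Pr_word G n w g = comm_pow 0 g" for g
      using True finite_tuples[of n] by (auto simp: Pr_word_eq_sum comm_pow_def)
    moreover have "\<not> nontrivial_word w"
      using True by (simp add: nontrivial_word_def free_eq_def)
    ultimately show ?thesis by (intro exI[of _ 0]) auto
  next
    case False
    from less.prems(1) False show ?thesis
    proof (cases rule: admissible_cases)
      case (adjacent u X v)
      have adm: "admissible (u @ v)"
        by (rule admissible_remove_pair(1)[OF less.prems(1), of _ X]) (simp add: adjacent)
      have uv: "u @ v \<in> words n"
        using less.prems(2) adjacent by (auto simp: words_def)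
      have "length (u @ v) < length w" by (simp add: adjacent)
      from less.hyps[OF this adm uv] obtain k where
        k: "nontrivial_word (u @ v) \<longrightarrow> k > 0"
        "\<And>g. g \<in> carrier G \<Longrightarrow> Pr_word G n (u @ v) g = comm_pow k g"
        by blast
      have "Pr_word G n w g = Pr_word G n (u @ v) g" for g
        unfolding Pr_word_def adjacent
        using word_val_well_defined[OF _ less.prems(2)[unfolded adjacent] uv free_eq_cancel]
        by (intro arg_cong2[where f = "(/)"] arg_cong[where f = "\<lambda>A. real (card A)"]) auto
      then show ?thesis
        using k nontrivial_cancel[of u X v] adjacent by (intro exI[of _ k]) auto
    next
      case (interleaved u X A Y B C D)
      let ?W = "u @ C @ B @ A @ D"
      have "admissible (u @ A @ [Y] @ B @ C @ [letter_inv Y] @ D)"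
        by (rule admissible_remove_pair(1)[OF less.prems(1), of _ X]) (simp add: interleaved)
      then have adm: "admissible ?W"
        by (rule admissible_remove_pair(1)[of _ _ Y]) simp
      have W: "?W \<in> words n"
        using less.prems(2) interleaved by (auto simp: words_def)
      have "length ?W < length w" by (simp add: interleaved)
      from less.hyps[OF this adm W] obtain k where
        k: "\<And>g. g \<in> carrier G \<Longrightarrow> Pr_word G n ?W g = comm_pow k g"
        by blast
      have "Pr_word G n w g = comm_pow (Suc k) g" if "g \<in> carrier G" for g
        unfolding Pr_word_interleaved[OF interleaved less.prems that] comm_pow_Suc comm_avg_def
        using that by (intro arg_cong2[where f = "(/)"] sum.cong refl k) auto
      then show ?thesis by blast
    qed
  qed
qed

end

section \<open>Comparison with the commuting probability\<close>

theorem proposition4p1p6: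
  fixes G :: "('a, 'b) monoid_scheme" (structure)
    and g :: 'a and n :: nat and \<omega> :: "letter list"
  assumes "group G"
    and "finite (carrier G)"
    and "g \<in> derived G (carrier G)"
    and "\<omega> \<in> words n"
    and "admissible \<omega>"
    and "nontrivial_word \<omega>"
  shows "(Pr_word G n \<omega> g \<le> Pr_word G n \<omega> \<one> \<and> Pr_word G n \<omega> \<one> \<le> Pr_comm G)
       \<and> (Pr_word G n \<omega> g = Pr_word G n \<omega> \<one> \<longleftrightarrow> g = \<one>)"
proof -
  interpret fin_group G
    using assms by (simp add: fin_group_def fin_group_axioms_def)
  have g: "g \<in> carrier G"
    using derived_in_carrier[of "carrier G"] assms(3) by blast
  obtain k where "k > 0" and Pr: "\<And>h. h \<in> carrier G \<Longrightarrow> Pr_word G n \<omega> h = comm_pow k h"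
    using Pr_word_eq_comm_pow[OF assms(5,4)] assms(6) by blast
  then have "comm_pow k \<one> \<le> Pr_comm G"
    using comm_pow_Suc_one_le[of "k - 1"] by simp
  then show ?thesis
    using comm_pow_less_one[OF g, of k] by (cases "g = \<one>") (auto simp: Pr g)
qed

end
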